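(* Let $A$, $\tilde M$ and $\hat M$ be $n\times n$ real matrices (all nonsingular) such that $$0\notin \mathcal{F}(A\tilde M^{-1})\cap\mathcal{F}(A\hat M^{-1}).$$ For an arbitrary initial guess $x^{(0)}$, let $x^{(\frac12)}$ and $x^{(1)}$ be computed by the first step of the TSTMR method, and let the subsequent iterates be computed by the TSTMR method (see the context). If $W_A(\delta^{(k)}_1,\delta^{(k)}_2)$ and $W_A(\delta^{(k+\frac12)}_1,\delta^{(k+\frac12)}_2)$ are nonsingular for $k=1,2,\ldots$, then for each $k\ge 0$ there exists a positive constant $\mathcal{L}_k<1$ such that $$\|r^{(k+1)}\|\le \mathcal{L}_k\,\|r^{(k)}\|.$$
   Context: The field of values of $W\in\mathbb{R}^{n\times n}$ is $\mathcal{F}(W)=\{\langle Wy,y\rangle/\langle y,y\rangle : 0\ne y\in\mathbb{C}^n\}$, where $\langle x,y\rangle=x^*y$ is the Euclidean inner product; $\|\cdot\|$ is the Euclidean norm. Let $A\in\mathbb{R}^{n\times n}$ be nonsingular, $b\in\mathbb{R}^n$, and let $A=\tilde M-\tilde N=\hat M-\hat N$ be two splittings with $\tilde M,\hat M\in\mathbb{R}^{n\times n}$ nonsingular. For $x,y\in\mathbb{R}^n$ set $$W_A(x,y)=\begin{bmatrix}\langle Ax,Ax\rangle & \langle Ay,Ax\rangle\\ \langle Ax,Ay\rangle & \langle Ay,Ay\rangle\end{bmatrix}.$$ The TSTMR method for $Ax=b$. Given an arbitrary $x^{(0)}\in\mathbb{R}^n$, write $r^{(j)}=b-Ax^{(j)}$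 and $r^{(j+\frac12)}=b-Ax^{(j+\frac12)}$ for residuals, and for all $j\ge 0$ set $\delta_1^{(j)}=\tilde M^{-1}r^{(j)}$, $\delta_1^{(j+\frac12)}=\hat M^{-1}r^{(j+\frac12)}$; for $j\ge1$ set $\delta_2^{(j)}=\delta_1^{(j)}-\delta_1^{(j-1)}$ and $\delta_2^{(j+\frac12)}=\delta_1^{(j+\frac12)}-\delta_1^{((j-1)+\frac12)}$. First step: $x^{(\frac12)}=x^{(0)}+\beta_0\delta_1^{(0)}$ and $x^{(1)}=x^{(\frac12)}+\gamma_0\delta_1^{(\frac12)}$ with $$\beta_0=\frac{\langle r^{(0)},A\delta_1^{(0)}\rangle}{\|A\delta_1^{(0)}\|^2},\qquad \gamma_0=\frac{\langle r^{(\frac12)},A\delta_1^{(\frac12)}\rangle}{\|A\delta_1^{(\frac12)}\|^2}$$ (it is understood that $r^{(0)}$ and $r^{(\frac12)}$ are nonzero, so that these are defined). For $j\ge1$: $x^{(j+\frac12)}=x^{(j)}+\beta_1^{(j)}\delta_1^{(j)}+\beta_2^{(j)}\delta_2^{(j)}$ and $x^{(j+1)}=x^{(j+\frac12)}+\gamma_1^{(j)}\delta_1^{(j+\frac12)}+\gamma_2^{(j)}\delta_2^{(j+\frac12)}$, where the coefficients solve $$W_A(\delta_1^{(j)},\delta_2^{(j)})\begin{bmatrix}\beta_1^{(j)}\\ \beta_2^{(j)}\end{bmatrix}=\begin{bmatrix}\langle r^{(j)},A\delta_1^{(j)}\rangle\\ \langle r^{(j)},A\delta_2^{(j)}\rangle\end{bmatrix},\qquad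 W_A(\delta_1^{(j+\frac12)},\delta_2^{(j+\frac12)})\begin{bmatrix}\gamma_1^{(j)}\\ \gamma_2^{(j)}\end{bmatrix}=\begin{bmatrix}\langle r^{(j+\frac12)},A\delta_1^{(j+\frac12)}\rangle\\ \langle r^{(j+\frac12)},A\delta_2^{(j+\frac12)}\rangle\end{bmatrix}.$$ *)

theory Defs
  imports "HOL-Analysis.Analysis"
begin

text \<open>The Euclidean inner product \<open>x\<^sup>* y\<close> on complex vectors, conjugate-linear in the first
  argument. (The library's \<open>\<bullet>\<close> on complex vectors is only its real part.)\<close>

definition cinner :: "complex^'n \<Rightarrow> complex^'n \<Rightarrow> complex" where
  "cinner x y = (\<Sum>i\<in>UNIV. cnj (x $ i) * y $ i)"

definition field_of_values :: "real^'n^'n \<Rightarrow> complex set" where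
  "field_of_values W =
     {cinner (map_matrix complex_of_real W *v y) y / cinner y y | y. y \<noteq> 0}"

definition W_matrix :: "real^'n^'n \<Rightarrow> real^'n \<Rightarrow> real^'n \<Rightarrow> real^2^2" where
  "W_matrix A x y =
     vector [vector [(A *v x) \<bullet> (A *v x), (A *v y) \<bullet> (A *v x)],
             vector [(A *v x) \<bullet> (A *v y), (A *v y) \<bullet> (A *v y)]]"

definition residual :: "real^'n^'n \<Rightarrow> real^'n \<Rightarrow> real^'n \<Rightarrow> real^'n" where
  "residual A b v = b - A *v v"

text \<open>The correction vectors along a sequence \<open>u\<close> of iterates. They are used with the integer-index
  iterates and the first splitting matrix, and with the half-index iterates and the second one.
  \<open>delta2\<close> is meant for \<open>j \<ge> 1\<close> only.\<close>

definition delta1 ::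
  "real^'n^'n \<Rightarrow> real^'n \<Rightarrow> real^'n^'n \<Rightarrow> (nat \<Rightarrow> real^'n) \<Rightarrow> nat \<Rightarrow> real^'n" where
  "delta1 A b M u j = matrix_inv M *v residual A b (u j)"

definition delta2 ::
  "real^'n^'n \<Rightarrow> real^'n \<Rightarrow> real^'n^'n \<Rightarrow> (nat \<Rightarrow> real^'n) \<Rightarrow> nat \<Rightarrow> real^'n" where
  "delta2 A b M u j = delta1 A b M u j - delta1 A b M u (j - 1)"

definition one_dim_step ::
  "real^'n^'n \<Rightarrow> real^'n \<Rightarrow> real^'n \<Rightarrow> real^'n \<Rightarrow> real^'n" where
  "one_dim_step A b v d =
     v + ((residual A b v \<bullet> (A *v d)) / (norm (A *v d))\<^sup>2) *\<^sub>R d"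

text \<open>A relation: the coefficients are required to solve the 2-by-2 system, and are unique as soon
  as its matrix is nonsingular.\<close>

definition two_dim_step ::
  "real^'n^'n \<Rightarrow> real^'n \<Rightarrow> real^'n \<Rightarrow> real^'n \<Rightarrow> real^'n \<Rightarrow> real^'n \<Rightarrow> bool" where
  "two_dim_step A b v d1 d2 v' \<longleftrightarrow>
     (\<exists>c1 c2. W_matrix A d1 d2 *v vector [c1, c2] =
                vector [residual A b v \<bullet> (A *v d1), residual A b v \<bullet> (A *v d2)] \<and>
              v' = v + c1 *\<^sub>R d1 + c2 *\<^sub>R d2)"

text \<open>\<open>tstmr A b Mt Mh x0 x xh\<close>: the sequences \<open>x j\<close> (for \<open>x\<^bsup>(j)\<^esup>\<close>) and \<open>xh j\<close> (for
  \<open>x\<^bsup>(j+1/2)\<^esup>\<close>) are produced by the TSTMR method for \<open>A x = b\<close> with initial guess \<open>x0\<close> and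
  splitting matrices \<open>Mt\<close> (M tilde) and \<open>Mh\<close> (M hat).\<close>

definition tstmr ::
  "real^'n^'n \<Rightarrow> real^'n \<Rightarrow> real^'n^'n \<Rightarrow> real^'n^'n \<Rightarrow> real^'n \<Rightarrow>
   (nat \<Rightarrow> real^'n) \<Rightarrow> (nat \<Rightarrow> real^'n) \<Rightarrow> bool" where
  "tstmr A b Mt Mh x0 x xh \<longleftrightarrow>
     x 0 = x0 \<and>
     xh 0 = one_dim_step A b (x 0) (delta1 A b Mt x 0) \<and>
     x 1 = one_dim_step A b (xh 0) (delta1 A b Mh xh 0) \<and>
     (\<forall>j\<ge>1.
        two_dim_step A b (x j) (delta1 A b Mt x j) (delta2 A b Mt x j) (xh j) \<and>
        two_dim_step A b (xh j) (delta1 A b Mh xh j) (delta2 A b Mh xh j) (x (j + 1)))"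

end

theory Submission
  imports Defs
begin

text \<open>Each half step replaces the residual \<open>r\<close> by its component orthogonal to the space spanned by
  the images under \<open>A\<close> of the correction vectors. So residual norms never increase, and they drop
  strictly unless \<open>r\<close> is orthogonal to \<open>A M\<^sup>-\<^sup>1 r\<close>. The latter is impossible for real \<open>r \<noteq> 0\<close> if
  \<open>0\<close> lies outside the field of values of \<open>A M\<^sup>-\<^sup>1\<close>, which holds for at least one of the two half
  steps.\<close>

text \<open>Regarded as a complex vector, \<open>r\<close> gives a quotient whose numerator is the
  real number \<open>r \<bullet> (W *v r)\<close>. If that vanished, this quotient would exhibit 0
  in the field of values.\<close>

lemma inner_neq_0_of_field_of_values:
  fixes W :: "real^'n^'n" and r :: "real^'n"
  assumes "0 \<notin> field_of_values W" and "r \<noteq> 0"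
  shows "r \<bullet> (W *v r) \<noteq> 0"
proof
  assume orth: "r \<bullet> (W *v r) = 0"
  define y :: "complex^'n" where "y = (\<chi> i. complex_of_real (r $ i))"
  have "map_matrix complex_of_real W *v y = (\<chi> i. complex_of_real ((W *v r) $ i))"
    by (simp add: vec_eq_iff y_def matrix_vector_mult_def map_matrix_def)
  then have "cinner (map_matrix complex_of_real W *v y) y = complex_of_real (r \<bullet> (W *v r))"
    by (simp add: cinner_def y_def inner_vec_def mult.commute)
  then have "cinner (map_matrix complex_of_real W *v y) y / cinner y y = 0"
    using orth by simp
  moreover have "y \<noteq> 0"
    using \<open>r \<noteq> 0\<close> by (auto simp: y_def vec_eq_iff)
  ultimately have "0 \<in> field_of_values W"
    unfolding field_of_values_def by force
  with assms(1) show False ..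
qed

lemma residual_diff: "residual A b v = residual A b v' + A *v (v' - v)"
  by (simp add: residual_def matrix_vector_mult_diff_distrib)

lemma one_dim_step_orthogonal:
  fixes A :: "real^'n^'n"
  assumes "v' = one_dim_step A b v d"
  shows "residual A b v' \<bullet> (A *v d) = 0" and "residual A b v' \<bullet> (A *v (v' - v)) = 0"
proof -
  define c where "c = (residual A b v \<bullet> (A *v d)) / (norm (A *v d))\<^sup>2"
  have v': "v' = v + c *\<^sub>R d"
    by (simp add: assms one_dim_step_def c_def)
  have "residual A b v' = residual A b v - c *\<^sub>R (A *v d)"
    by (simp add: v' residual_def matrix_vector_right_distrib matrix_vector_mult_scaleR)
  \<comment> \<open>If \<open>A *v d\<close> is nonzero, \<open>c\<close> is the projection
    coefficient; if it is zero, the inner product vanishes trivially.\<close>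
  then show *: "residual A b v' \<bullet> (A *v d) = 0"
    by (simp add: inner_diff_left c_def power2_norm_eq_inner)
  show "residual A b v' \<bullet> (A *v (v' - v)) = 0"
    using * by (simp add: v' matrix_vector_mult_scaleR)
qed

text \<open>The 2-by-2 system consists of the normal equations for minimising the norm of
  \<open>residual A b v - c1 *\<^sub>R (A *v d1) - c2 *\<^sub>R (A *v d2)\<close>. Each row is one
  orthogonality relation, and the update \<open>v' - v\<close> lies in the span of \<open>d1\<close>
  and \<open>d2\<close>.\<close>

lemma two_dim_step_orthogonal:
  fixes A :: "real^'n^'n"
  assumes "two_dim_step A b v d1 d2 v'"
  shows "residual A b v' \<bullet> (A *v d1) = 0" and "residual A b v' \<bullet> (A *v (v' - v)) = 0"
proof -
  obtain c1 c2 where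
    eqs: "W_matrix A d1 d2 *v vector [c1, c2] =
            vector [residual A b v \<bullet> (A *v d1), residual A b v \<bullet> (A *v d2)]"
    and v': "v' = v + c1 *\<^sub>R d1 + c2 *\<^sub>R d2"
    using assms by (auto simp: two_dim_step_def)
  have r': "residual A b v' = residual A b v - c1 *\<^sub>R (A *v d1) - c2 *\<^sub>R (A *v d2)"
    by (simp add: v' residual_def matrix_vector_right_distrib matrix_vector_mult_scaleR)
  have eq1: "(A *v d1) \<bullet> (A *v d1) * c1 + (A *v d2) \<bullet> (A *v d1) * c2 = residual A b v \<bullet> (A *v d1)"
    and eq2: "(A *v d1) \<bullet> (A *v d2) * c1 + (A *v d2) \<bullet> (A *v d2) * c2 = residual A b v \<bullet> (A *v d2)"
    using arg_cong[OF eqs, of "\<lambda>u. u $ 1"] arg_cong[OF eqs, of "\<lambda>u. u $ 2"]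
    by (simp_all add: matrix_vector_mult_def W_matrix_def sum_2)
  show orth1: "residual A b v' \<bullet> (A *v d1) = 0"
    using eq1 by (simp add: r' inner_diff_left mult.commute)
  have orth2: "residual A b v' \<bullet> (A *v d2) = 0"
    using eq2 by (simp add: r' inner_diff_left mult.commute)
  show "residual A b v' \<bullet> (A *v (v' - v)) = 0"
    using orth1 orth2
    by (simp add: v' matrix_vector_right_distrib matrix_vector_mult_scaleR inner_add_right)
qed

lemma norm_residual_Pythagorean:
  fixes A :: "real^'n^'n"
  assumes "residual A b v' \<bullet> (A *v (v' - v)) = 0"
  shows "(norm (residual A b v))\<^sup>2 = (norm (residual A b v'))\<^sup>2 + (norm (A *v (v' - v)))\<^sup>2"
  using assms by (subst residual_diff[of A b v v']) (simp add: norm_add_Pythagorean orthogonal_def)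

lemma norm_residual_le:
  fixes A :: "real^'n^'n"
  assumes "residual A b v' \<bullet> (A *v (v' - v)) = 0"
  shows "norm (residual A b v') \<le> norm (residual A b v)"
  using norm_residual_Pythagorean[OF assms] by (intro power2_le_imp_le[OF _ norm_ge_zero]) simp

lemma norm_residual_less:
  fixes A M :: "real^'n^'n"
  assumes fov: "0 \<notin> field_of_values (A ** matrix_inv M)"
    and orth1: "residual A b v' \<bullet> (A *v (matrix_inv M *v residual A b v)) = 0"
    and orth2: "residual A b v' \<bullet> (A *v (v' - v)) = 0"
    and nz: "residual A b v \<noteq> 0"
  shows "norm (residual A b v') < norm (residual A b v)"
proof -
  have "residual A b v \<bullet> (A *v (matrix_inv M *v residual A b v)) \<noteq> 0"
    using inner_neq_0_of_field_of_values[OF fov nz] by (simp add: matrix_vector_mul_assoc)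
  \<comment> \<open>Otherwise the step would leave the residual unchanged, and \<open>orth1\<close>
    would contradict the preceding fact.\<close>
  then have "A *v (v' - v) \<noteq> 0"
    using orth1 residual_diff[of A b v v'] by auto
  with norm_residual_Pythagorean[OF orth2] show ?thesis
    by (intro power2_less_imp_less[OF _ norm_ge_zero]) simp
qed

text \<open>This treats all steps alike: a half step projects along one direction for
  \<open>k = 0\<close> and along two afterwards, always including the first correction
  vector.\<close>

lemma tstmr_orthogonal:
  fixes A :: "real^'n^'n"
  assumes "tstmr A b Mt Mh x0 x xh"
  shows "residual A b (xh k) \<bullet> (A *v (matrix_inv Mt *v residual A b (x k))) = 0"
    and "residual A b (xh k) \<bullet> (A *v (xh k - x k)) = 0"
    and "residual A b (x (k + 1)) \<bullet> (A *v (matrix_inv Mh *v residual A b (xh k))) = 0"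
    and "residual A b (x (k + 1)) \<bullet> (A *v (x (k + 1) - xh k)) = 0"
proof -
  note orthogonal =
    one_dim_step_orthogonal[of "xh 0" A b "x 0" "delta1 A b Mt x 0"]
    one_dim_step_orthogonal[of "x 1" A b "xh 0" "delta1 A b Mh xh 0"]
    two_dim_step_orthogonal[of A b "x k" "delta1 A b Mt x k" "delta2 A b Mt x k" "xh k"]
    two_dim_step_orthogonal[of A b "xh k" "delta1 A b Mh xh k" "delta2 A b Mh xh k" "x (k + 1)"]
  have "residual A b (xh k) \<bullet> (A *v delta1 A b Mt x k) = 0 \<and>
        residual A b (xh k) \<bullet> (A *v (xh k - x k)) = 0 \<and>
        residual A b (x (k + 1)) \<bullet> (A *v delta1 A b Mh xh k) = 0 \<and>
        residual A b (x (k + 1)) \<bullet> (A *v (x (k + 1) - xh k)) = 0"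
  proof (cases "k = 0")
    case True
    have "xh 0 = one_dim_step A b (x 0) (delta1 A b Mt x 0)"
      and "x 1 = one_dim_step A b (xh 0) (delta1 A b Mh xh 0)"
      using assms by (simp_all add: tstmr_def)
    with True orthogonal(1-4) show ?thesis by simp
  next
    case False
    with assms orthogonal(5-8) show ?thesis
      by (simp add: tstmr_def)
  qed
  then show "residual A b (xh k) \<bullet> (A *v (matrix_inv Mt *v residual A b (x k))) = 0"
    and "residual A b (xh k) \<bullet> (A *v (xh k - x k)) = 0"
    and "residual A b (x (k + 1)) \<bullet> (A *v (matrix_inv Mh *v residual A b (xh k))) = 0"
    and "residual A b (x (k + 1)) \<bullet> (A *v (x (k + 1) - xh k)) = 0"
    by (simp_all add: delta1_def)
qed

text \<open>Strictness is asked only for nonzero \<open>t\<close>, since the iteration may already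
  have reached the solution; then \<open>s\<close> is 0 too and any factor works.\<close>

lemma contraction_factor_exists:
  fixes s t :: real
  assumes "0 \<le> s" and "s \<le> t" and "t \<noteq> 0 \<Longrightarrow> s < t"
  shows "\<exists>L. 0 < L \<and> L < 1 \<and> s \<le> L * t"
proof (cases "t = 0")
  case True
  with assms show ?thesis by (intro exI[of _ "1/2"]) simp
next
  case False
  with assms have "0 < t" "s < t" by auto
  \<comment> \<open>The midpoint of \<open>s / t\<close> and \<open>1\<close>: the ratio \<open>s / t\<close> itself may be \<open>0\<close>.\<close>
  with \<open>0 \<le> s\<close> show ?thesis
    by (intro exI[of _ "(s / t + 1) / 2"]) (simp add: field_simps)
qed

theorem theorem2p5:
  fixes A Mt Nt Mh Nh :: "real^'n^'n"
    and b x0 :: "real^'n"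
    and x xh :: "nat \<Rightarrow> real^'n"
  assumes "invertible A" and "invertible Mt" and "invertible Mh"
    and "A = Mt - Nt" and "A = Mh - Nh"
    and "0 \<notin> field_of_values (A ** matrix_inv Mt) \<inter> field_of_values (A ** matrix_inv Mh)"
    and "tstmr A b Mt Mh x0 x xh"
    and "residual A b (x 0) \<noteq> 0" and "residual A b (xh 0) \<noteq> 0"
    and "\<And>k. k \<ge> 1 \<Longrightarrow> invertible (W_matrix A (delta1 A b Mt x k) (delta2 A b Mt x k))"
    and "\<And>k. k \<ge> 1 \<Longrightarrow> invertible (W_matrix A (delta1 A b Mh xh k) (delta2 A b Mh xh k))"
  shows "\<forall>k. \<exists>L::real. 0 < L \<and> L < 1 \<and>
           norm (residual A b (x (k + 1))) \<le> L * norm (residual A b (x k))"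
proof
  fix k
  note orth = tstmr_orthogonal[OF assms(7), of k]
  have le1: "norm (residual A b (xh k)) \<le> norm (residual A b (x k))"
    and le2: "norm (residual A b (x (k + 1))) \<le> norm (residual A b (xh k))"
    using norm_residual_le[OF orth(2)] norm_residual_le[OF orth(4)] .
  have "norm (residual A b (x (k + 1))) < norm (residual A b (x k))"
    if nz: "residual A b (x k) \<noteq> 0"
  \<comment> \<open>The case decides which half step supplies the strict decrease; the other only
    has to be nonincreasing.\<close>
  proof (cases "0 \<in> field_of_values (A ** matrix_inv Mt)")
    case False
    from norm_residual_less[OF this orth(1,2) nz] le2 show ?thesis by simp
  next
    case True
    with assms(6) have fov: "0 \<notin> field_of_values (A ** matrix_inv Mh)" by blast
    show ?thesis
    \<comment> \<open>If the first half step already hits the solution, the norm has dropped from a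
      positive value to 0 and stays there.\<close>
    proof (cases "residual A b (xh k) = 0")
      case True
      with le2 nz show ?thesis by simp
    next
      case False
      from norm_residual_less[OF fov orth(3,4) this] le1 show ?thesis by simp
    qed
  qed
  with le1 le2 show "\<exists>L::real. 0 < L \<and> L < 1 \<and>
      norm (residual A b (x (k + 1))) \<le> L * norm (residual A b (x k))"
    by (intro contraction_factor_exists) auto
qed

end
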